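(* Let $r\ge2$. Any connected $r$-uniform bipartite hypergraph $\mathbb H=(V,\mathcal H)$ is non-stabilizable.
   Context: A hypergraph $\mathbb H=(V,\mathcal H)$ consists of a finite node set $V$ and a finite set $\mathcal H$ of subsets of $V$ (hyperedges) with union $V$. All hypergraphs are assumed simple (no hyperedge is contained in another one) and connected (the graph whose vertices are the hyperedges, with two hyperedges adjacent when they intersect, is connected). An $r$-uniform hypergraph (all hyperedges have cardinality $r$) is called $r$-uniform bipartite if there is a partition $V_1,V_2$ of $V$ such that $|H\cap V_1|=1$ and $|H\cap V_2|=r-1$ for every $H\in\mathcal H$. $\mathscr M(V)$ is the set of probability measures $\mu$ on $V$ with $\mu(i)>0$ for all $i$. Matching model $(\mathbb H,\Phi,\mu)$: at each time $n\ge1$ one item enters; its class $C_n\in V$ is drawn from $\mu$, i.i.d. If the buffer contains a set of items whose classes form, together with $C_n$, a hyperedge (one item per class), the policy $\Phi$ selects one such set and these items leave immediately together with the incoming item (a match is always performed whenever possible); otherwise the incoming item is stored. $W_n$ is the word over $V$ listing the classes of unmatched items after the arrival at time $n$, in order of arrival; it takes values in the set of words in which, for each hyperedge, some class of the hyperedge does not occur. $\Phi$ is admissible if the choice of the match depends solely on the queue detail (the word) upon arrival and the incoming class, and possibly on an independent uniform draw in case of a tie; then $(W_n)$ is a Markov chain. The model is stable if $(W_n)$ is positive recurrent; $\mathrm{Stab}(\mathbb H,\Phi)$ is the set of $\mu\in\mathscr M(V)$ for which it is stable. $\mathbb H$ is non-stabilizable if $\mathrm{Stab}(\mathbb H,\Phi)=\emptyset$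 for every admissible $\Phi$. *)

theory Defs
  imports "HOL-Probability.Probability_Mass_Function"
begin

section \<open>Hypergraphs\<close>

definition hypergraph :: "'a set \<Rightarrow> 'a set set \<Rightarrow> bool" where
  "hypergraph V E \<longleftrightarrow> finite V \<and> finite E \<and> \<Union>E = V"

definition simple_hypergraph :: "'a set set \<Rightarrow> bool" where
  "simple_hypergraph E \<longleftrightarrow> (\<forall>H\<in>E. \<forall>H'\<in>E. H \<subseteq> H' \<longrightarrow> H = H')"

definition connected_hypergraph :: "'a set set \<Rightarrow> bool" where
  "connected_hypergraph E \<longleftrightarrow>
     (\<forall>H\<in>E. \<forall>H'\<in>E. (H, H') \<in> {(A, B). A \<in> E \<and> B \<in> E \<and> A \<inter> B \<noteq> {}}\<^sup>*)"

definition uniform_hypergraph :: "nat \<Rightarrow> 'a set set \<Rightarrow> bool" where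
  "uniform_hypergraph r E \<longleftrightarrow> (\<forall>H\<in>E. card H = r)"

definition uniform_bipartite_hypergraph :: "nat \<Rightarrow> 'a set \<Rightarrow> 'a set set \<Rightarrow> bool" where
  "uniform_bipartite_hypergraph r V E \<longleftrightarrow>
     uniform_hypergraph r E \<and>
     (\<exists>V1 V2. V1 \<union> V2 = V \<and> V1 \<inter> V2 = {} \<and>
        (\<forall>H\<in>E. card (H \<inter> V1) = 1 \<and> card (H \<inter> V2) = r - 1))"


section \<open>Positive recurrence of a discrete Markov chain\<close>

text \<open>The joint law of the first \<open>n\<close> steps after time \<open>0\<close>, that is of
  \<open>[W\<^sub>1, \<dots>, W\<^sub>n]\<close>, for the chain with transition kernel \<open>K\<close> and \<open>W\<^sub>0 = x\<close>.\<close>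

primrec trajectory :: "('s \<Rightarrow> 's pmf) \<Rightarrow> nat \<Rightarrow> 's \<Rightarrow> 's list pmf" where
  "trajectory K 0 x = return_pmf []"
| "trajectory K (Suc n) x = bind_pmf (K x) (\<lambda>y. map_pmf ((#) y) (trajectory K n y))"

text \<open>The probability, starting from \<open>x\<close>, that the first return time
  \<open>inf {n \<ge> 1. W\<^sub>n = x}\<close> equals \<open>n\<close> (hence \<open>0\<close> for \<open>n = 0\<close>).\<close>

definition first_return_prob :: "('s \<Rightarrow> 's pmf) \<Rightarrow> 's \<Rightarrow> nat \<Rightarrow> real" where
  "first_return_prob K x n =
     measure_pmf.prob (trajectory K n x) {ws. ws \<noteq> [] \<and> last ws = x \<and> x \<notin> set (butlast ws)}"

text \<open>The return time is almost surely finite and has finite expectation.\<close>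

definition positive_recurrent_state :: "('s \<Rightarrow> 's pmf) \<Rightarrow> 's \<Rightarrow> bool" where
  "positive_recurrent_state K x \<longleftrightarrow>
     first_return_prob K x sums 1 \<and> summable (\<lambda>n. real n * first_return_prob K x n)"

definition positive_recurrent :: "'s set \<Rightarrow> ('s \<Rightarrow> 's pmf) \<Rightarrow> bool" where
  "positive_recurrent S K \<longleftrightarrow> (\<forall>x\<in>S. positive_recurrent_state K x)"


section \<open>The matching model\<close>

text \<open>The state space: words over \<open>V\<close> in which no hyperedge has all its classes present.\<close>

definition buffer_words :: "'a set \<Rightarrow> 'a set set \<Rightarrow> 'a list set" where
  "buffer_words V E = {w \<in> lists V. \<forall>H\<in>E. \<not> H \<subseteq> set w}"

text \<open>The sets of stored items that form a match with an incoming item of class \<open>c\<close>.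
  Stored items are identified by their positions in the word \<open>w\<close>, so a policy also
  decides which items of a given class are used.\<close>

definition matches :: "'a set set \<Rightarrow> 'a list \<Rightarrow> 'a \<Rightarrow> nat set set" where
  "matches E w c = {S. S \<subseteq> {..<length w} \<and> inj_on ((!) w) S \<and> c \<notin> (!) w ` S \<and>
                       insert c ((!) w ` S) \<in> E}"

text \<open>A policy assigns to the queue detail \<open>w\<close> and the incoming class \<open>c\<close> the law of the
  selected match; a randomised choice represents the independent draw that breaks ties.
  The value is irrelevant when there is no possible match.\<close>

type_synonym 'a policy = "'a list \<Rightarrow> 'a \<Rightarrow> nat set pmf"

definition admissible :: "'a set \<Rightarrow> 'a set set \<Rightarrow> 'a policy \<Rightarrow> bool" where
  "admissible V E \<Phi> \<longleftrightarrow>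
     (\<forall>w\<in>buffer_words V E. \<forall>c\<in>V. matches E w c \<noteq> {} \<longrightarrow> set_pmf (\<Phi> w c) \<subseteq> matches E w c)"

definition arrival_update :: "'a set set \<Rightarrow> 'a policy \<Rightarrow> 'a list \<Rightarrow> 'a \<Rightarrow> 'a list pmf" where
  "arrival_update E \<Phi> w c =
     (if matches E w c = {} then return_pmf (w @ [c])
      else map_pmf (\<lambda>S. nths w (- S)) (\<Phi> w c))"

text \<open>The transition kernel of the Markov chain of the words \<open>W\<^sub>n\<close>: each arriving class is
  drawn from \<open>\<mu>\<close> independently of the past.\<close>

definition matching_kernel :: "'a set set \<Rightarrow> 'a policy \<Rightarrow> 'a pmf \<Rightarrow> 'a list \<Rightarrow> 'a list pmf" where
  "matching_kernel E \<Phi> \<mu> w = bind_pmf \<mu> (arrival_update E \<Phi> w)"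

lemma matching_kernel_closed:
  assumes "admissible V E \<Phi>" "set_pmf \<mu> = V" "w \<in> buffer_words V E"
  shows "set_pmf (matching_kernel E \<Phi> \<mu> w) \<subseteq> buffer_words V E"
proof
  fix v assume "v \<in> set_pmf (matching_kernel E \<Phi> \<mu> w)"
  then obtain c where c: "c \<in> V" and v: "v \<in> set_pmf (arrival_update E \<Phi> w c)"
    using assms(2) by (auto simp: matching_kernel_def)
  show "v \<in> buffer_words V E"
  proof (cases "matches E w c = {}")
    case True
    have "\<not> H \<subseteq> set (w @ [c])" if "H \<in> E" for H
    proof
      assume H: "H \<subseteq> set (w @ [c])"
      have "c \<in> H" using H \<open>H \<in> E\<close> assms(3) by (auto simp: buffer_words_def)
      have "H - {c} \<subseteq> (!) w ` {..<length w}"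
        using H by (fastforce simp: in_set_conv_nth)
      then obtain S where "S \<subseteq> {..<length w}" "inj_on ((!) w) S" "(!) w ` S = H - {c}"
        by (metis subset_image_inj)
      with \<open>c \<in> H\<close> \<open>H \<in> E\<close> have "S \<in> matches E w c"
        by (simp add: matches_def insert_absorb)
      with True show False by simp
    qed
    moreover have "v = w @ [c]" using True v by (simp add: arrival_update_def)
    ultimately show ?thesis
      using c assms(3) unfolding buffer_words_def by simp
  next
    case False
    with v obtain S where "v = nths w (- S)" by (auto simp: arrival_update_def)
    then have "set v \<subseteq> set w" by (simp add: set_nths_subset)
    moreover have "set w \<subseteq> V" "\<forall>H\<in>E. \<not> H \<subseteq> set w"
      using assms(3) by (auto simp: buffer_words_def)
    ultimately show ?thesis unfolding buffer_words_def by blast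
  qed
qed

definition full_support_measures :: "'a set \<Rightarrow> 'a pmf set" where
  "full_support_measures V = {\<mu>. set_pmf \<mu> = V}"

definition stable :: "'a set \<Rightarrow> 'a set set \<Rightarrow> 'a policy \<Rightarrow> 'a pmf \<Rightarrow> bool" where
  "stable V E \<Phi> \<mu> \<longleftrightarrow> positive_recurrent (buffer_words V E) (matching_kernel E \<Phi> \<mu>)"

definition Stab :: "'a set \<Rightarrow> 'a set set \<Rightarrow> 'a policy \<Rightarrow> 'a pmf set" where
  "Stab V E \<Phi> = {\<mu> \<in> full_support_measures V. stable V E \<Phi> \<mu>}"

definition non_stabilizable :: "'a set \<Rightarrow> 'a set set \<Rightarrow> bool" where
  "non_stabilizable V E \<longleftrightarrow> (\<forall>\<Phi>. admissible V E \<Phi> \<longrightarrow> Stab V E \<Phi> = {})"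

end

theory Submission
  imports Defs
begin

text \<open>
  Give every class of \<open>V\<^sub>1\<close> the weight \<open>r - 1\<close> and every class of \<open>V\<^sub>2\<close> the weight \<open>- 1\<close>. Each
  hyperedge then has total weight \<open>0\<close>, so a match never changes the total weight \<open>D\<close> of all the
  items that are present, counting the incoming one. Whatever the policy does, \<open>D (W\<^sub>n)\<close> therefore
  is a random walk: its increments are the weights of the arriving classes, which are i.i.d. and
  never \<open>0\<close>. A return of \<open>W\<^sub>n\<close> to the empty word forces a return of this walk to \<open>0\<close>, and the
  expected time of any such return is infinite, with or without drift.

  The last claim is proved for every Markov chain that carries a random walk
  (\<open>random_walk_functional_not_positive_recurrent\<close>). Let \<open>T\<close> be the return time to \<open>x\<close> and let \<open>\<phi>\<close>
  be the characteristic function of the step law. Under the one-step kernel the function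
  \<open>v \<mapsto> cis (t * D v)\<close> is multiplied by \<open>\<phi> t\<close>. If \<open>T\<close> has finite expectation, summing this
  relation along an excursion from \<open>x\<close> gives
  \[ (1 - \<phi>(t)) \, E \Bigl[ \sum_{n < T} e^{i t D(W_n)} \Bigr]
       = e^{i t D(x)} - E [ e^{i t D(W_T)} ] = 0 , \]
  because \<open>W\<^sub>T = x\<close>. A step law with a nonzero atom has \<open>\<phi> t \<noteq> 1\<close> along a sequence \<open>t \<rightarrow> 0\<close>, so
  the expected sum vanishes along that sequence
  (\<open>killed_expectation_eigenfunction_sum\<close>). By dominated convergence it also tends to the
  expectation of \<open>T\<close>, which would have to be \<open>0\<close> although \<open>T \<ge> 1\<close>.
\<close>

section \<open>Expectations killed at the first visit to a state\<close>

lemma integrable_measure_pmf_bounded: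
  fixes f :: "'s \<Rightarrow> 'b::{banach,second_countable_topology}"
  assumes "\<And>v. norm (f v) \<le> B"
  shows "integrable (measure_pmf p) f"
  by (rule measure_pmf.integrable_const_bound[where B=B]) (use assms in auto)

text \<open>The expectation of \<open>g (W\<^sub>n)\<close> on the event that the chain started in \<open>w\<close> avoids \<open>x\<close> at the times
  \<open>1, \<dots>, n\<close>. The start is exempt from the avoidance, so that for \<open>w = x\<close> and \<open>g = 1\<close> this is the
  probability that the return time to \<open>x\<close> exceeds \<open>n\<close>.\<close>

primrec killed_expectation ::
  "('s \<Rightarrow> 's pmf) \<Rightarrow> 's \<Rightarrow> ('s \<Rightarrow> 'b::{banach,second_countable_topology}) \<Rightarrow> nat \<Rightarrow> 's \<Rightarrow> 'b" where
  "killed_expectation K x g 0 w = g w"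
| "killed_expectation K x g (Suc n) w =
     (\<integral>v. (if v = x then 0 else killed_expectation K x g n v) \<partial>K w)"

text \<open>This extends \<open>first_return_prob\<close> to starting points other than the target, which a
  recursion on the first step needs.\<close>

definition first_passage_prob :: "('s \<Rightarrow> 's pmf) \<Rightarrow> 's \<Rightarrow> nat \<Rightarrow> 's \<Rightarrow> real" where
  "first_passage_prob K x n w =
     measure_pmf.prob (trajectory K n w) {ws. ws \<noteq> [] \<and> last ws = x \<and> x \<notin> set (butlast ws)}"

lemma first_passage_prob_0 [simp]: "first_passage_prob K x 0 w = 0"
  by (simp add: first_passage_prob_def)

lemma length_trajectory: "ws \<in> set_pmf (trajectory K n w) \<Longrightarrow> length ws = n"
  by (induction n arbitrary: ws w) auto

lemma first_passage_prob_Suc: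
  "first_passage_prob K x (Suc n) w =
     (\<integral>v. (if v = x then if n = 0 then 1 else 0 else first_passage_prob K x n v) \<partial>K w)"
proof -
  let ?A = "{ws. ws \<noteq> [] \<and> last ws = x \<and> x \<notin> set (butlast ws)}"
  have "first_passage_prob K x (Suc n) w =
      (\<integral>v. measure_pmf.prob (map_pmf ((#) v) (trajectory K n v)) ?A \<partial>K w)"
    unfolding first_passage_prob_def trajectory.simps measure_pmf_bind
    by (rule measure_pmf.measure_bind) (auto simp: measurable_def space_subprob_algebra
        intro: measure_pmf.subprob_space_axioms)
  also have "\<dots> = (\<integral>v. (if v = x then if n = 0 then 1 else 0 else first_passage_prob K x n v) \<partial>K w)"
  proof (rule Bochner_Integration.integral_cong[OF refl])
    fix v
    show "measure_pmf.prob (map_pmf ((#) v) (trajectory K n v)) ?A =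
        (if v = x then if n = 0 then 1 else 0 else first_passage_prob K x n v)"
    proof (cases "n = 0")
      case True
      then show ?thesis by (simp add: first_passage_prob_def)
    next
      case False
      have "measure_pmf.prob (map_pmf ((#) v) (trajectory K n v)) ?A =
          measure_pmf.prob (trajectory K n v) (if v = x then {} else ?A)"
        unfolding measure_map_pmf
        \<comment> \<open>The rest of the trajectory is nonempty, so the first step is not the last one and it
          must itself avoid \<open>x\<close>.\<close>
        by (rule measure_pmf.finite_measure_eq_AE)
          (use False in \<open>auto simp: AE_measure_pmf_iff dest!: length_trajectory\<close>)
      then show ?thesis using False by (simp add: first_passage_prob_def)
    qed
  qed
  finally show ?thesis .
qed

lemma norm_killed_expectation_le_1:
  assumes "\<And>v. norm (g v) \<le> 1"
  shows "norm (killed_expectation K x g n w) \<le> 1"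
proof (induction n arbitrary: w)
  case (Suc n)
  have "norm (killed_expectation K x g (Suc n) w) \<le>
      (\<integral>v. norm (if v = x then 0 else killed_expectation K x g n v) \<partial>K w)"
    by simp
  also have "\<dots> \<le> (\<integral>v. 1 \<partial>K w)"
    by (intro integral_mono integrable_measure_pmf_bounded[where B=1]) (use Suc in auto)
  finally show ?case by simp
qed (use assms in simp)

lemma norm_killed_expectation_le_survival:
  assumes "\<And>v. norm (g v) \<le> 1"
  shows "norm (killed_expectation K x g n w) \<le> killed_expectation K x (\<lambda>_. 1::real) n w"
proof (induction n arbitrary: w)
  case (Suc n)
  have 1: "norm (killed_expectation K x g n v) \<le> 1" for v
    using assms by (rule norm_killed_expectation_le_1)
  have 2: "\<bar>killed_expectation K x (\<lambda>_. 1::real) n v\<bar> \<le> 1" for v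
    using norm_killed_expectation_le_1[of "\<lambda>_. 1::real"] by simp
  have "norm (killed_expectation K x g (Suc n) w) \<le>
      (\<integral>v. norm (if v = x then 0 else killed_expectation K x g n v) \<partial>K w)"
    by simp
  also have "\<dots> \<le> killed_expectation K x (\<lambda>_. 1::real) (Suc n) w"
    unfolding killed_expectation.simps
    by (intro integral_mono integrable_measure_pmf_bounded[where B=1]) (use Suc 1 2 in auto)
  finally show ?case .
qed (use assms in simp)

text \<open>Expand one more step of the path after time \<open>n\<close>: by the eigenfunction property it multiplies
  the killed expectation by \<open>c\<close>, and the mass that has just reached \<open>x\<close>, where \<open>g\<close> takes the value
  \<open>g x\<close>, has to be separated from the mass that survives. The case \<open>g = 1\<close>, \<open>c = 1\<close> is
  \<open>P (T > n) = P (T > n + 1) + P (T = n + 1)\<close>.\<close>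

lemma killed_expectation_eigenfunction:
  fixes g :: "'s \<Rightarrow> 'b::{real_normed_field,banach,second_countable_topology}"
  assumes g: "\<And>v. norm (g v) \<le> 1"
    and closed: "\<And>w. w \<in> S \<Longrightarrow> set_pmf (K w) \<subseteq> S"
    and eigen: "\<And>w. w \<in> S \<Longrightarrow> (\<integral>v. g v \<partial>K w) = c * g w"
    and "w \<in> S"
  shows "c * killed_expectation K x g n w =
      killed_expectation K x g (Suc n) w + first_passage_prob K x (Suc n) w *\<^sub>R g x"
  using \<open>w \<in> S\<close>
proof (induction n arbitrary: w)
  case 0
  have "c * g w = (\<integral>v. (if v = x then 0 else g v) + (if v = x then 1 else 0) *\<^sub>R g x \<partial>K w)"
    unfolding eigen[OF 0, symmetric] by (rule Bochner_Integration.integral_cong) auto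
  also have "\<dots> = (\<integral>v. (if v = x then 0 else g v) \<partial>K w) + (\<integral>v. (if v = x then 1 else 0) *\<^sub>R g x \<partial>K w)"
    by (intro Bochner_Integration.integral_add integrable_measure_pmf_bounded[where B=1])
      (use g in auto)
  also have "(\<integral>v. (if v = x then 1 else 0) *\<^sub>R g x \<partial>K w)
      = (\<integral>v. (if v = x then 1 else 0) \<partial>K w) *\<^sub>R g x"
    by (intro integral_scaleR_left integrable_measure_pmf_bounded[where B=1]) auto
  finally show ?case
    by (simp add: first_passage_prob_Suc[of K x 0] cong: if_cong)
next
  case (Suc n)
  have k: "norm (killed_expectation K x g m v) \<le> 1" for m v
    using g by (rule norm_killed_expectation_le_1)
  have p: "\<bar>first_passage_prob K x m v\<bar> \<le> 1" for m v
    by (simp add: first_passage_prob_def)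
  have "c * killed_expectation K x g (Suc n) w =
      (\<integral>v. (if v = x then 0 else c * killed_expectation K x g n v) \<partial>K w)"
    unfolding killed_expectation.simps
    by (subst integral_mult_right_zero[symmetric], rule Bochner_Integration.integral_cong) auto
  also have "\<dots> = (\<integral>v. (if v = x then 0 else killed_expectation K x g (Suc n) v)
      + (if v = x then 0 else first_passage_prob K x (Suc n) v) *\<^sub>R g x \<partial>K w)"
    by (rule integral_cong_AE)
      (use closed[OF Suc.prems] in \<open>auto simp: AE_measure_pmf_iff Suc.IH simp del: killed_expectation.simps\<close>)
  also have "\<dots> = (\<integral>v. (if v = x then 0 else killed_expectation K x g (Suc n) v) \<partial>K w)
      + (\<integral>v. (if v = x then 0 else first_passage_prob K x (Suc n) v) *\<^sub>R g x \<partial>K w)"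
    by (intro Bochner_Integration.integral_add integrable_measure_pmf_bounded[where B=1])
      (use k p g in \<open>auto simp: mult_le_one simp del: killed_expectation.simps\<close>)
  also have "(\<integral>v. (if v = x then 0 else first_passage_prob K x (Suc n) v) *\<^sub>R g x \<partial>K w)
      = (\<integral>v. (if v = x then 0 else first_passage_prob K x (Suc n) v) \<partial>K w) *\<^sub>R g x"
    by (intro integral_scaleR_left integrable_measure_pmf_bounded[where B=1]) (use p in auto)
  finally show ?case
    by (simp add: first_passage_prob_Suc[of K x "Suc n"] cong: if_cong)
qed

lemma tendsto_killed_expectation:
  assumes g: "\<And>j v. norm (g j v) \<le> 1"
    and lim: "\<And>v. (\<lambda>j. g j v) \<longlonglongrightarrow> h v"
  shows "(\<lambda>j. killed_expectation K x (g j) n w) \<longlonglongrightarrow> killed_expectation K x h n w"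
proof (induction n arbitrary: w)
  case (Suc n)
  have "norm (killed_expectation K x (g j) n v) \<le> 1" for j v
    using g by (rule norm_killed_expectation_le_1)
  with Suc show ?case unfolding killed_expectation.simps
    by (intro integral_dominated_convergence[where w="\<lambda>_. 1"]) auto
qed (use lim in simp)

section \<open>Random walks carried by a Markov chain\<close>

text \<open>The sum of the survival probabilities is the expected return time. Convergence is obtained by
  summation by parts, in which the boundary term \<open>n * P (T > n)\<close> is at most the tail
  of the series \<open>k * P (T = k)\<close>.\<close>

lemma positive_recurrent_state_survival:
  assumes "positive_recurrent_state K x"
    and closed: "\<And>w. w \<in> S \<Longrightarrow> set_pmf (K w) \<subseteq> S" and "x \<in> S"
  shows "summable (\<lambda>n. killed_expectation K x (\<lambda>_. 1::real) n x)"
proof -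
  define p where "p n = first_passage_prob K x n x" for n
  define u where "u n = killed_expectation K x (\<lambda>_. 1::real) n x" for n
  have p: "p sums 1" "summable (\<lambda>n. real n * p n)" and p0: "p n \<ge> 0" for n
    using assms(1) unfolding positive_recurrent_state_def p_def[abs_def]
      first_passage_prob_def first_return_prob_def by auto
  have rec: "u n = u (Suc n) + p (Suc n)" for n
    using killed_expectation_eigenfunction[where g="\<lambda>_. 1::real" and c=1 and S=S] closed \<open>x \<in> S\<close>
    unfolding u_def p_def by fastforce
  have u: "u n = 1 - (\<Sum>k\<le>n. p k)" for n
  proof (induction n)
    case (Suc n)
    then show ?case using rec[of n] by simp
  qed (simp add: u_def p_def)
  have u0: "u n \<ge> 0" for n
    using norm_killed_expectation_le_survival[of "\<lambda>_. 1::real" K x n x] unfolding u_def by simp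
  have tail: "u n = (\<Sum>k. p (k + Suc n))" for n
    using suminf_split_initial_segment[OF sums_summable[OF p(1)], of "Suc n"] sums_unique[OF p(1)]
    by (simp add: u lessThan_Suc_atMost)
  have le: "(\<Sum>i<n. u i) \<le> (\<Sum>k. real k * p k)" for n
  proof -
    have sum: "(\<Sum>i<n. u i) = (\<Sum>k<Suc n. real k * p k) + real n * u n"
    proof (induction n)
      case (Suc n)
      then show ?case using rec[of n] by (simp add: algebra_simps)
    qed simp
    have s: "summable (\<lambda>k. p (k + Suc n))"
      using sums_summable[OF p(1)] by (rule summable_ignore_initial_segment)
    have "real n * u n = (\<Sum>k. real n * p (k + Suc n))"
      unfolding tail by (rule suminf_mult[OF s, symmetric])
    also have "\<dots> \<le> (\<Sum>k. real (k + Suc n) * p (k + Suc n))"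
      using s p(2) p0 summable_ignore_initial_segment[OF p(2), of "Suc n"]
      by (intro suminf_le summable_mult mult_right_mono) auto
    finally show ?thesis
      using sum suminf_split_initial_segment[OF p(2), of "Suc n"] by simp
  qed
  show ?thesis
    using summableI_nonneg_bounded[of u, OF u0 le] unfolding u_def .
qed

text \<open>The sum is the expectation of \<open>g\<close> summed over an excursion from \<open>x\<close>. Multiplied by \<open>c - 1\<close> it
  telescopes to the expected value of \<open>g\<close> at the end of the excursion minus its value at the
  beginning; both are \<open>g x\<close>.\<close>

lemma killed_expectation_eigenfunction_sum:
  fixes g :: "'s \<Rightarrow> complex"
  assumes rec: "positive_recurrent_state K x"
    and closed: "\<And>w. w \<in> S \<Longrightarrow> set_pmf (K w) \<subseteq> S" and x: "x \<in> S"
    and g: "\<And>v. norm (g v) \<le> 1"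
    and eigen: "\<And>w. w \<in> S \<Longrightarrow> (\<integral>v. g v \<partial>K w) = c * g w" and c: "c \<noteq> 1"
  shows "(\<Sum>n. killed_expectation K x g n x) = 0"
proof -
  define a where "a n = killed_expectation K x g n x" for n
  define p where "p n = first_passage_prob K x n x" for n
  have p: "p sums 1"
    using rec unfolding positive_recurrent_state_def p_def[abs_def]
      first_passage_prob_def first_return_prob_def by auto
  have a: "summable a"
    using summable_comparison_test'[OF positive_recurrent_state_survival[OF rec closed x]
        norm_killed_expectation_le_survival[OF g]] unfolding a_def .
  have 1: "(c - 1) * a n = (a (Suc n) - a n) + p (Suc n) *\<^sub>R g x" for n
    using killed_expectation_eigenfunction[where S=S and g=g, OF g closed eigen x, of x n]
    unfolding a_def p_def by (simp add: algebra_simps)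
  have "(\<lambda>n. a (Suc n) - a n) sums (0 - a 0)"
    by (rule telescope_sums[OF summable_LIMSEQ_zero[OF a]])
  moreover have "(\<lambda>n. p (Suc n) *\<^sub>R g x) sums (1 *\<^sub>R g x)"
    using p by (intro sums_scaleR_left) (simp add: sums_Suc_iff, simp add: p_def)
  ultimately have "(\<lambda>n. (c - 1) * a n) sums ((0 - a 0) + 1 *\<^sub>R g x)"
    unfolding 1 by (rule sums_add)
  moreover have "(\<lambda>n. (c - 1) * a n) sums ((c - 1) * suminf a)"
    using a by (intro sums_mult summable_sums)
  ultimately have "(c - 1) * suminf a = 0"
    using sums_unique2 by (fastforce simp: a_def)
  with c show ?thesis unfolding a_def by simp
qed

text \<open>If the integral were \<open>1\<close>, its real part would make the nonnegative function
  \<open>1 - cos (t * y)\<close> have mean \<open>0\<close>, hence vanish at every atom.\<close>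

lemma char_fun_pmf_neq_1:
  fixes \<nu> :: "real pmf"
  assumes s: "s \<in> set_pmf \<nu>" and "cos (t * s) \<noteq> 1"
  shows "(\<integral>y. cis (t * y) \<partial>\<nu>) \<noteq> 1"
proof
  assume eq: "(\<integral>y. cis (t * y) \<partial>\<nu>) = 1"
  have "integrable \<nu> (\<lambda>y. cis (t * y))"
    by (rule integrable_measure_pmf_bounded[where B=1]) simp
  then have "(\<integral>y. cos (t * y) \<partial>\<nu>) = 1"
    using eq integral_Re[of \<nu> "\<lambda>y. cis (t * y)"] by simp
  moreover have i: "integrable \<nu> (\<lambda>y. cos (t * y))"
    by (rule integrable_measure_pmf_bounded[where B=1]) simp
  ultimately have "(\<integral>y. 1 - cos (t * y) \<partial>\<nu>) = 0"
    by (subst Bochner_Integration.integral_diff) auto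
  then have "AE y in \<nu>. 1 - cos (t * y) = 0"
    by (subst (asm) integral_nonneg_eq_0_iff_AE) (use i in auto)
  with s assms(2) show False by (auto simp: AE_measure_pmf_iff)
qed

text \<open>Wald's first identity would exclude a nonzero drift and his second one a drift \<open>0\<close>. Testing the
  excursion against characters of small frequency treats both cases at once.\<close>

theorem random_walk_functional_not_positive_recurrent:
  fixes D :: "'s \<Rightarrow> real" and \<nu> :: "real pmf"
  assumes closed: "\<And>w. w \<in> S \<Longrightarrow> set_pmf (K w) \<subseteq> S"
    and walk: "\<And>w. w \<in> S \<Longrightarrow> map_pmf D (K w) = map_pmf (\<lambda>y. D w + y) \<nu>"
    and s: "s \<in> set_pmf \<nu>" "s \<noteq> 0" and x: "x \<in> S"
  shows "\<not> positive_recurrent_state K x"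
proof
  assume rec: "positive_recurrent_state K x"
  \<comment> \<open>The frequencies tend to \<open>0\<close>, and \<open>t j * s\<close> stays in \<open>(0, 1]\<close>, where the cosine is below \<open>1\<close>.\<close>
  define t where "t j = 1 / (real (Suc j) * s)" for j
  define a where "a n j = killed_expectation K x (\<lambda>v. cis (t j * D v)) n x" for n j
  let ?u = "\<lambda>n. killed_expectation K x (\<lambda>_. 1::real) n x"
  let ?b = "\<lambda>n. killed_expectation K x (\<lambda>_. 1::complex) n x"
  have u: "summable ?u"
    using positive_recurrent_state_survival[OF rec closed x] .
  have zero: "(\<Sum>n. a n j) = 0" for j
    unfolding a_def
  proof (rule killed_expectation_eigenfunction_sum[OF rec closed x])
    fix w assume w: "w \<in> S"
    have "(\<integral>v. cis (t j * D v) \<partial>K w) = (\<integral>y. cis (t j * y) \<partial>map_pmf D (K w))"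
      by simp
    also have "\<dots> = (\<integral>y. cis (t j * y) * cis (t j * D w) \<partial>\<nu>)"
      unfolding walk[OF w] by (simp add: cis_mult algebra_simps)
    finally show "(\<integral>v. cis (t j * D v) \<partial>K w) = (\<integral>y. cis (t j * y) \<partial>\<nu>) * cis (t j * D w)"
      by simp
  next
    have "t j * s = 1 / real (Suc j)"
      using s(2) by (simp add: t_def)
    moreover have "0 < 1 / real (Suc j)" "1 / real (Suc j) \<le> 1" by auto
    moreover have "1 < pi" using pi_gt3 by simp
    ultimately have "cos (t j * s) < cos 0"
      by (intro cos_monotone_0_pi) linarith+
    then show "(\<integral>y. cis (t j * y) \<partial>\<nu>) \<noteq> 1"
      using char_fun_pmf_neq_1[OF s(1)] by fastforce
  qed auto
  have "(\<lambda>j. (1 / s) * (1 / real (Suc j))) \<longlonglongrightarrow> (1 / s) * 0"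
    by (intro tendsto_mult tendsto_const lim_1_over_n[THEN LIMSEQ_Suc])
  then have "t \<longlonglongrightarrow> 0"
    unfolding t_def[abs_def] by (simp add: field_simps)
  then have "(\<lambda>j. cis (t j * D v)) \<longlonglongrightarrow> cis (0 * D v)" for v
    by (intro tendsto_intros)
  then have lim: "(\<lambda>j. a n j) \<longlonglongrightarrow> ?b n" for n
    unfolding a_def by (intro tendsto_killed_expectation) auto
  have b: "?b n = of_real (?u n)" for n
  proof -
    have "killed_expectation K x (\<lambda>_. 1::complex) n w = of_real (killed_expectation K x (\<lambda>_. 1::real) n w)" for w
    proof (induction n arbitrary: w)
      case (Suc n)
      then show ?case
        by (simp flip: integral_complex_of_real add: if_distrib cong: if_cong)
    qed simp
    then show ?thesis .
  qed
  have "(\<lambda>j. \<Sum>n. a n j) \<longlonglongrightarrow> suminf ?b"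
    using tannerys_theorem[of a ?b sequentially ?u, OF lim _ u] 
      norm_killed_expectation_le_survival[of "\<lambda>v. cis (t _ * D v)" K x _ x]
    unfolding a_def by (auto simp: case_prod_unfold)
  then have "suminf ?b = 0"
    unfolding zero using LIMSEQ_unique tendsto_const by blast
  then have "suminf ?u = 0"
    unfolding b using suminf_of_real[OF u, where 'a=complex] by simp
  moreover have "0 \<le> ?u n" for n
    using norm_killed_expectation_le_survival[of "\<lambda>_. 1::real" K x n x] by simp
  ultimately have "?u 0 = 0"
    using suminf_eq_zero_iff[OF u] by blast
  then show False by simp
qed

section \<open>Matching models with a balanced weight\<close>

lemma sum_list_map_nths:
  fixes f :: "'a \<Rightarrow> 'b::comm_monoid_add"
  shows "sum_list (map f (nths w A)) = (\<Sum>i | i < length w \<and> i \<in> A. f (w ! i))"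
proof (induction w rule: rev_induct)
  case (snoc c w)
  have "{i. i < length (w @ [c]) \<and> i \<in> A} =
      (if length w \<in> A then insert (length w) {i. i < length w \<and> i \<in> A} else {i. i < length w \<and> i \<in> A})"
    by (auto simp: less_Suc_eq)
  then show ?case
    using snoc by (auto simp: nths_append nth_append add.commute intro!: sum.cong)
qed simp

text \<open>The matched items and the arriving one together have the weight \<open>0\<close> of a hyperedge, so their
  departure adds \<open>f c\<close> to the weight of the buffer, exactly as storing the arrival would.\<close>

lemma sum_list_remove_match:
  fixes f :: "'a \<Rightarrow> real"
  assumes fin: "\<And>H. H \<in> E \<Longrightarrow> finite H" and balanced: "\<And>H. H \<in> E \<Longrightarrow> sum f H = 0"
    and S: "S \<in> matches E w c"
  shows "sum_list (map f (nths w (- S))) = sum_list (map f w) + f c"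
proof -
  have S': "S \<subseteq> {..<length w}" "inj_on ((!) w) S" "c \<notin> (!) w ` S" "insert c ((!) w ` S) \<in> E"
    using S by (auto simp: matches_def)
  have "finite S" using S'(1) finite_subset by blast
  then have "f c + (\<Sum>i\<in>S. f (w ! i)) = 0"
    using balanced[OF S'(4)] S'(3) by (simp add: sum.reindex[OF S'(2)])
  moreover have "(\<Sum>i<length w. f (w ! i)) = (\<Sum>i\<in>{..<length w} - S. f (w ! i)) + (\<Sum>i\<in>S. f (w ! i))"
    by (rule sum.subset_diff[OF S'(1)]) simp
  moreover have "{i. i < length w \<and> i \<in> - S} = {..<length w} - S" by auto
  moreover have "sum_list (map f w) = (\<Sum>i<length w. f (w ! i))"
    by (simp add: sum_list_sum_nth atLeast0LessThan)
  ultimately show ?thesis by (simp add: sum_list_map_nths)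
qed

text \<open>Storing and matching change the weight of the buffer by the same amount, so the choices of
  the policy are invisible to it and it performs a random walk.\<close>

theorem balanced_weight_non_stabilizable:
  fixes f :: "'a \<Rightarrow> real"
  assumes fin: "\<And>H. H \<in> E \<Longrightarrow> finite H" and "{} \<notin> E"
    and balanced: "\<And>H. H \<in> E \<Longrightarrow> sum f H = 0"
    and c: "c \<in> V" "f c \<noteq> 0"
  shows "non_stabilizable V E"
  unfolding non_stabilizable_def
proof (intro allI impI equals0I)
  fix \<Phi> \<mu> assume \<Phi>: "admissible V E \<Phi>" and "\<mu> \<in> Stab V E \<Phi>"
  then have \<mu>: "set_pmf \<mu> = V"
    and stable: "positive_recurrent (buffer_words V E) (matching_kernel E \<Phi> \<mu>)"
    by (auto simp: Stab_def full_support_measures_def stable_def)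
  let ?D = "\<lambda>w. sum_list (map f w)"
  have empty: "[] \<in> buffer_words V E"
    using \<open>{} \<notin> E\<close> by (auto simp: buffer_words_def)
  have step: "map_pmf ?D (arrival_update E \<Phi> w d) = return_pmf (?D w + f d)"
    if "w \<in> buffer_words V E" "d \<in> V" for w d
  proof (cases "matches E w d = {}")
    case False
    then have "set_pmf (\<Phi> w d) \<subseteq> matches E w d"
      using \<Phi> that by (auto simp: admissible_def)
    then have "map_pmf (\<lambda>S. ?D (nths w (- S))) (\<Phi> w d) = map_pmf (\<lambda>_. ?D w + f d) (\<Phi> w d)"
      by (intro map_pmf_cong refl) (use sum_list_remove_match[OF fin balanced] in blast)
    with False show ?thesis
      by (simp add: arrival_update_def pmf.map_comp comp_def)
  qed (simp add: arrival_update_def)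
  have "map_pmf ?D (matching_kernel E \<Phi> \<mu> w) = map_pmf (\<lambda>y. ?D w + y) (map_pmf f \<mu>)"
    if "w \<in> buffer_words V E" for w
  proof -
    have "map_pmf ?D (matching_kernel E \<Phi> \<mu> w) = bind_pmf \<mu> (\<lambda>d. return_pmf (?D w + f d))"
      unfolding matching_kernel_def map_bind_pmf
      by (intro bind_pmf_cong refl) (use step[OF that] \<mu> in auto)
    then show ?thesis by (simp add: map_pmf_def bind_assoc_pmf bind_return_pmf)
  qed
  then have "\<not> positive_recurrent_state (matching_kernel E \<Phi> \<mu>) []"
    by (rule random_walk_functional_not_positive_recurrent[where s="f c" and S="buffer_words V E", rotated])
      (use matching_kernel_closed[OF \<Phi> \<mu>] c \<mu> empty in auto)
  with stable empty show False by (auto simp: positive_recurrent_def)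
qed

theorem proposition4p7:
  fixes r :: nat and V :: "'a set" and E :: "'a set set"
  assumes "r \<ge> 2"
    and "hypergraph V E" and "simple_hypergraph E" and "connected_hypergraph E"
    and "uniform_bipartite_hypergraph r V E"
  shows "non_stabilizable V E"
proof (cases "V = {}")
  case True
  then show ?thesis
    using set_pmf_not_empty by (auto simp: non_stabilizable_def Stab_def full_support_measures_def)
next
  case False
  then obtain c where c: "c \<in> V" by blast
  obtain V1 V2 where V: "V1 \<union> V2 = V" "V1 \<inter> V2 = {}"
    and H: "\<And>H. H \<in> E \<Longrightarrow> card (H \<inter> V1) = 1 \<and> card (H \<inter> V2) = r - 1"
    using assms(5) by (auto simp: uniform_bipartite_hypergraph_def)
  have E: "finite H" "H \<subseteq> V" if "H \<in> E" for H
    using assms(2) that by (auto simp: hypergraph_def intro: finite_subset)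
  define f :: "'a \<Rightarrow> real" where "f i = (if i \<in> V1 then real r - 1 else - 1)" for i
  have "sum f H = 0" if "H \<in> E" for H
  proof -
    have split: "H = (H \<inter> V1) \<union> (H \<inter> V2)" using E(2)[OF that] V(1) by blast
    have "sum f H = sum f (H \<inter> V1) + sum f (H \<inter> V2)"
      by (subst split, rule sum.union_disjoint) (use E(1)[OF that] V(2) in auto)
    also have "sum f (H \<inter> V1) = (\<Sum>i\<in>H \<inter> V1. real r - 1)"
      by (rule sum.cong) (auto simp: f_def)
    also have "sum f (H \<inter> V2) = (\<Sum>i\<in>H \<inter> V2. - 1)"
      by (rule sum.cong) (use V(2) in \<open>auto simp: f_def\<close>)
    finally show ?thesis using H[OF that] assms(1) by (simp add: of_nat_diff)
  qed
  moreover have "{} \<notin> E" using H by fastforce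
  moreover have "f c \<noteq> 0" using assms(1) by (simp add: f_def)
  ultimately show ?thesis
    using balanced_weight_non_stabilizable E(1) c by metis
qed

end
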